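(* Let $n\ge 1$. For an MR-subalgebra $A$ of $\mathcal L_n$ let $f(A)$ be the number of $\varphi\in\mathrm{Aut}(\mathcal L_n)$ with $\varphi\restriction A=\mathrm{id}_A$, and let $s(A)$ be the number of $\varphi\in\mathrm{Aut}(\mathcal L_n)$ such that $\varphi\restriction A=\mathrm{id}_A$ and $\varphi\restriction B\ne\mathrm{id}_B$ for every MR-subalgebra $B\supsetneq A$. Let $\mu$ be the Möbius function of the poset of MR-subalgebras of $\mathcal L_n$ ordered by inclusion. Then for every MR-subalgebra $A$, $$s(A)=\sum_{B\supseteq A}\mu(A,B)\,f(B),$$ the sum being over MR-subalgebras $B$ of $\mathcal L_n$ containing $A$. In particular, the number of derangements of the $n$-cube, i.e. of automorphisms of $\mathcal L_n$ whose only fixed element is $\mathbf 1$, is $$s(\{\mathbf 1\})=\sum_{B}\mu(\{\mathbf 1\},B)\,f(B),$$ the sum being over all MR-subalgebras $B$ of $\mathcal L_n$.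
   Context: $\mathcal L_n$ is the face poset of the $n$-cube, represented as the set of signed subsets of $\{1,\dots,n\}$: pairs $(X_1,X_2)$ with $X_1,X_2\subseteq\{1,\dots,n\}$, $X_1\cap X_2=\emptyset$, ordered by $(X_1,X_2)\le(Y_1,Y_2)$ iff $Y_1\subseteq X_1$ and $Y_2\subseteq X_2$. It has maximum $\mathbf 1=(\emptyset,\emptyset)$ and joins (componentwise intersection). For $y=(Y_1,Y_2)\le x=(X_1,X_2)$ put $\Delta(x,y)=(X_1\cup(Y_2\setminus X_2),\,X_2\cup(Y_1\setminus X_1))$ (reflection of $y$ through the centre of $x$). The caret operation $x\mathbin{\hat{}}y=x\wedge\Delta(x\vee y,y)$ is always defined. An MR-subalgebra of $\mathcal L_n$ is a subset containing $\mathbf 1$ and closed under $\vee$, under $\Delta(x,y)$ for $y\le x$, and under caret. $\mathrm{Aut}(\mathcal L_n)$ is the group of bijections of $\mathcal L_n$ preserving $\le$ in both directions and $\Delta$. *)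

theory Defs
  imports "HOL-Combinatorics.Permutations"
begin

section \<open>The face poset of the \<open>n\<close>-cube\<close>

type_synonym face = "nat set \<times> nat set"

definition cube :: "nat \<Rightarrow> face set" where
  "cube n = {(X1, X2). X1 \<subseteq> {1..n} \<and> X2 \<subseteq> {1..n} \<and> X1 \<inter> X2 = {}}"

definition face_le :: "face \<Rightarrow> face \<Rightarrow> bool" where
  "face_le x y \<longleftrightarrow> fst y \<subseteq> fst x \<and> snd y \<subseteq> snd x"

definition face_one :: face where
  "face_one = ({}, {})"

definition face_join :: "face \<Rightarrow> face \<Rightarrow> face" where
  "face_join x y = (fst x \<inter> fst y, snd x \<inter> snd y)"

text \<open>The reflection of \<open>y\<close> through the centre of \<open>x\<close>; meaningful only if \<open>face_le y x\<close>.\<close>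

definition face_refl :: "face \<Rightarrow> face \<Rightarrow> face" where
  "face_refl x y = (fst x \<union> (snd y - snd x), snd x \<union> (fst y - fst x))"

text \<open>
  Meets in \<open>cube n\<close> are partial. The value of \<open>face_meet\<close> is unspecified if there is no
  greatest lower bound; lemma \<open>face_caret_is_meet\<close> shows that this does not occur in a caret.
\<close>

definition is_face_meet :: "nat \<Rightarrow> face \<Rightarrow> face \<Rightarrow> face \<Rightarrow> bool" where
  "is_face_meet n x y z \<longleftrightarrow> z \<in> cube n \<and> face_le z x \<and> face_le z y \<and>
     (\<forall>w\<in>cube n. face_le w x \<longrightarrow> face_le w y \<longrightarrow> face_le w z)"

definition face_meet :: "nat \<Rightarrow> face \<Rightarrow> face \<Rightarrow> face" where
  "face_meet n x y = (THE z. is_face_meet n x y z)"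

definition face_caret :: "nat \<Rightarrow> face \<Rightarrow> face \<Rightarrow> face" where
  "face_caret n x y = face_meet n x (face_refl (face_join x y) y)"

definition MR_subalgebra :: "nat \<Rightarrow> face set \<Rightarrow> bool" where
  "MR_subalgebra n A \<longleftrightarrow> A \<subseteq> cube n \<and> face_one \<in> A \<and>
     (\<forall>x\<in>A. \<forall>y\<in>A. face_join x y \<in> A) \<and>
     (\<forall>x\<in>A. \<forall>y\<in>A. face_le y x \<longrightarrow> face_refl x y \<in> A) \<and>
     (\<forall>x\<in>A. \<forall>y\<in>A. face_caret n x y \<in> A)"

text \<open>
  A bijection of \<open>cube n\<close> is represented by its extension by the identity to all of type
  \<^typ>\<open>face\<close> (\<open>permutes\<close>), so that distinct automorphisms are distinct functions.
\<close>

definition cube_Aut :: "nat \<Rightarrow> (face \<Rightarrow> face) set" where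
  "cube_Aut n = {\<phi>. \<phi> permutes cube n \<and>
     (\<forall>x\<in>cube n. \<forall>y\<in>cube n. face_le x y \<longleftrightarrow> face_le (\<phi> x) (\<phi> y)) \<and>
     (\<forall>x\<in>cube n. \<forall>y\<in>cube n. face_le y x \<longrightarrow> \<phi> (face_refl x y) = face_refl (\<phi> x) (\<phi> y))}"

definition fixes_on :: "(face \<Rightarrow> face) \<Rightarrow> face set \<Rightarrow> bool" where
  "fixes_on \<phi> A \<longleftrightarrow> (\<forall>x\<in>A. \<phi> x = x)"

definition num_fixing :: "nat \<Rightarrow> face set \<Rightarrow> nat" where
  "num_fixing n A = card {\<phi> \<in> cube_Aut n. fixes_on \<phi> A}"

definition num_fixing_exactly :: "nat \<Rightarrow> face set \<Rightarrow> nat" where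
  "num_fixing_exactly n A = card {\<phi> \<in> cube_Aut n. fixes_on \<phi> A \<and>
     (\<forall>B. MR_subalgebra n B \<longrightarrow> A \<subset> B \<longrightarrow> \<not> fixes_on \<phi> B)}"

definition cube_derangements :: "nat \<Rightarrow> (face \<Rightarrow> face) set" where
  "cube_derangements n = {\<phi> \<in> cube_Aut n. {x \<in> cube n. \<phi> x = x} = {face_one}}"


section \<open>The Moebius function of a finite poset\<close>

text \<open>
  The poset is the set \<open>P\<close> with the order inherited from the type (inclusion, if \<open>P\<close> is a set of
  sets). The value is \<open>0\<close> outside the pairs \<open>x \<le> y\<close> in \<open>P\<close>, and for infinite \<open>P\<close>.
\<close>

function moebius :: "'a::order set \<Rightarrow> 'a \<Rightarrow> 'a \<Rightarrow> int" where
  "moebius P x y =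
     (if finite P \<and> x \<in> P \<and> y \<in> P \<and> x \<le> y
      then if x = y then 1 else - (\<Sum>z\<in>{z\<in>P. x \<le> z \<and> z < y}. moebius P x z)
      else 0)"
  by pat_completeness auto
termination
proof (relation "measure (\<lambda>(P, x, y). card {z\<in>P. z < y})", goal_cases)
  case 1
  show ?case by simp
next
  case (2 P x y z)
  then have "{w\<in>P. w < z} \<subset> {w\<in>P. w < y}" by auto
  with 2 show ?case by (simp add: psubset_card_mono)
qed

declare moebius.simps [simp del]


section \<open>Well-definedness\<close>

lemma face_join_in_cube: "x \<in> cube n \<Longrightarrow> y \<in> cube n \<Longrightarrow> face_join x y \<in> cube n"
  by (auto simp: cube_def face_join_def)

lemma face_join_least:
  "face_le x (face_join x y)" "face_le y (face_join x y)"
  "face_le x z \<Longrightarrow> face_le y z \<Longrightarrow> face_le (face_join x y) z"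
  by (auto simp: face_le_def face_join_def)

lemma face_refl_in_cube:
  "x \<in> cube n \<Longrightarrow> y \<in> cube n \<Longrightarrow> face_le y x \<Longrightarrow> face_refl x y \<in> cube n"
  by (auto simp: cube_def face_refl_def face_le_def)

lemma is_face_meet_unique: "is_face_meet n x y z \<Longrightarrow> is_face_meet n x y z' \<Longrightarrow> z = z'"
  by (metis (no_types, lifting) is_face_meet_def face_le_def subset_antisym prod_eq_iff)

lemma face_meet_eqI: "is_face_meet n x y z \<Longrightarrow> face_meet n x y = z"
  unfolding face_meet_def by (blast intro: the_equality is_face_meet_unique)

lemma face_caret_is_meet:
  assumes "x \<in> cube n" "y \<in> cube n"
  shows "is_face_meet n x (face_refl (face_join x y) y)
           (fst x \<union> (snd y - snd x), snd x \<union> (fst y - fst x))"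
  using assms
  by (auto simp: is_face_meet_def cube_def face_le_def face_refl_def face_join_def)

lemma face_caret_eq:
  assumes "x \<in> cube n" "y \<in> cube n"
  shows "face_caret n x y = (fst x \<union> (snd y - snd x), snd x \<union> (fst y - fst x))"
  unfolding face_caret_def by (rule face_meet_eqI [OF face_caret_is_meet [OF assms]])

lemma finite_cube: "finite (cube n)"
  by (rule finite_subset [of _ "Pow {1..n} \<times> Pow {1..n}"]) (auto simp: cube_def)

lemma finite_cube_Aut: "finite (cube_Aut n)"
  by (rule finite_subset [OF _ finite_permutations [OF finite_cube [of n]]])
     (auto simp: cube_Aut_def)

lemma finite_MR_subalgebras: "finite {A. MR_subalgebra n A}"
  by (rule finite_subset [of _ "Pow (cube n)"]) (auto simp: MR_subalgebra_def finite_cube)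

lemma MR_subalgebra_one: "MR_subalgebra n {face_one}"
proof -
  have "face_one \<in> cube n" by (simp add: cube_def face_one_def)
  then show ?thesis
    using face_caret_eq [of face_one n face_one]
    by (simp add: MR_subalgebra_def face_one_def face_join_def face_refl_def)
qed

end

(* The elements fixed by an automorphism phi form an MR-subalgebra Fix phi, because phi commutes
   with joins, reflections and carets.  Hence phi fixes A exactly when A is contained in Fix phi,
   and it fixes no larger MR-subalgebra precisely when Fix phi = A.  The formula is then Moebius
   inversion: exchanging the sums over B and phi, the coefficient of phi is the sum of mu(A,B)
   over the interval from A to Fix phi, which is 1 if Fix phi = A and 0 otherwise. *)
theory Submission
  imports Defs
begin

lemma face_le_refl [simp]: "face_le x x"
  by (simp add: face_le_def)

lemma face_le_antisym: "face_le x y \<Longrightarrow> face_le y x \<Longrightarrow> x = y"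
  by (auto simp: face_le_def prod_eq_iff)

lemma face_le_one: "face_le x face_one"
  by (simp add: face_le_def face_one_def)

lemma face_one_in_cube: "face_one \<in> cube n"
  by (simp add: cube_def face_one_def)

lemma face_caret_in_cube:
  assumes "x \<in> cube n" "y \<in> cube n"
  shows "face_caret n x y \<in> cube n"
  using assms by (auto simp: face_caret_eq cube_def)

lemma cube_Aut_in_cube: "\<phi> \<in> cube_Aut n \<Longrightarrow> x \<in> cube n \<Longrightarrow> \<phi> x \<in> cube n"
  by (simp add: cube_Aut_def permutes_in_image)

lemma cube_Aut_surj:
  assumes "\<phi> \<in> cube_Aut n" "y \<in> cube n"
  obtains x where "x \<in> cube n" "\<phi> x = y"
  using assms unfolding cube_Aut_def by (metis (no_types, lifting) mem_Collect_eq permutes_image imageE)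

lemma cube_Aut_le_iff:
  "\<phi> \<in> cube_Aut n \<Longrightarrow> x \<in> cube n \<Longrightarrow> y \<in> cube n \<Longrightarrow> face_le (\<phi> x) (\<phi> y) \<longleftrightarrow> face_le x y"
  by (simp add: cube_Aut_def)

lemma cube_Aut_refl:
  "\<phi> \<in> cube_Aut n \<Longrightarrow> x \<in> cube n \<Longrightarrow> y \<in> cube n \<Longrightarrow> face_le y x \<Longrightarrow>
     \<phi> (face_refl x y) = face_refl (\<phi> x) (\<phi> y)"
  by (simp add: cube_Aut_def)

text \<open>Surjectivity is the point: some element is mapped to the maximum, and as that element
  lies below \<open>face_one\<close>, monotonicity puts the maximum below
  \<open>\<phi> face_one\<close>.\<close>

lemma cube_Aut_one:
  assumes "\<phi> \<in> cube_Aut n"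
  shows "\<phi> face_one = face_one"
proof -
  obtain x where "x \<in> cube n" "\<phi> x = face_one"
    using assms face_one_in_cube by (rule cube_Aut_surj)
  then have "face_le face_one (\<phi> face_one)"
    using assms by (metis cube_Aut_le_iff face_le_one face_one_in_cube)
  then show ?thesis
    by (simp add: face_le_antisym face_le_one)
qed

text \<open>Joins are least upper bounds within \<open>cube n\<close>, hence determined by the
  order, which \<open>\<phi>\<close> preserves in both directions.\<close>

lemma cube_Aut_join:
  assumes \<phi>: "\<phi> \<in> cube_Aut n" and x: "x \<in> cube n" and y: "y \<in> cube n"
  shows "\<phi> (face_join x y) = face_join (\<phi> x) (\<phi> y)"
proof (rule face_le_antisym)
  have xy: "\<phi> x \<in> cube n" "\<phi> y \<in> cube n"
    using \<phi> x y by (auto intro: cube_Aut_in_cube)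
  \<comment> \<open>The join of the images is pulled back to \<open>z\<close>; reflecting the order
    makes \<open>z\<close> an upper bound of \<open>x\<close> and \<open>y\<close>, so it lies above
    their join.\<close>
  obtain z where z: "z \<in> cube n" "\<phi> z = face_join (\<phi> x) (\<phi> y)"
    using \<phi> face_join_in_cube [OF xy] by (rule cube_Aut_surj)
  then have "face_le x z" "face_le y z"
    using \<phi> x y by (metis cube_Aut_le_iff face_join_least(1,2))+
  then show "face_le (\<phi> (face_join x y)) (face_join (\<phi> x) (\<phi> y))"
    using \<phi> x y z by (metis cube_Aut_le_iff face_join_in_cube face_join_least(3))
  show "face_le (face_join (\<phi> x) (\<phi> y)) (\<phi> (face_join x y))"
    using \<phi> x y by (simp add: cube_Aut_le_iff face_join_in_cube face_join_least)
qed

text \<open>Phrased with the relation because meets are partial and \<open>face_meet\<close> is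
  unspecified where none exists. A competing lower bound of the images is pulled back along the
  surjection \<open>\<phi>\<close>.\<close>

lemma is_face_meet_cube_Aut:
  assumes \<phi>: "\<phi> \<in> cube_Aut n" and xy: "x \<in> cube n" "y \<in> cube n" and z: "is_face_meet n x y z"
  shows "is_face_meet n (\<phi> x) (\<phi> y) (\<phi> z)"
  unfolding is_face_meet_def
proof (intro conjI ballI impI)
  show "\<phi> z \<in> cube n" "face_le (\<phi> z) (\<phi> x)" "face_le (\<phi> z) (\<phi> y)"
    using \<phi> xy z by (auto simp: is_face_meet_def cube_Aut_in_cube cube_Aut_le_iff)
next
  fix w assume w: "w \<in> cube n" "face_le w (\<phi> x)" "face_le w (\<phi> y)"
  obtain v where v: "v \<in> cube n" "\<phi> v = w"
    using \<phi> w(1) by (rule cube_Aut_surj)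
  then show "face_le w (\<phi> z)"
    using \<phi> xy z w by (auto simp: is_face_meet_def cube_Aut_le_iff)
qed

lemma cube_Aut_caret:
  assumes \<phi>: "\<phi> \<in> cube_Aut n" and x: "x \<in> cube n" and y: "y \<in> cube n"
  shows "\<phi> (face_caret n x y) = face_caret n (\<phi> x) (\<phi> y)"
proof -
  let ?r = "face_refl (face_join x y) y"
  have j: "face_join x y \<in> cube n" "face_le y (face_join x y)"
    using x y by (auto intro: face_join_in_cube face_join_least)
  have r: "?r \<in> cube n"
    using j y by (intro face_refl_in_cube)
  \<comment> \<open>The meet in a caret exists, so the caret can be transported as a genuine
    greatest lower bound; uniqueness of meets then identifies its image.\<close>
  have "is_face_meet n x ?r (face_caret n x y)"
    using face_caret_is_meet [OF x y] face_caret_eq [OF x y] by simp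
  then have "is_face_meet n (\<phi> x) (\<phi> ?r) (\<phi> (face_caret n x y))"
    by (rule is_face_meet_cube_Aut [OF \<phi> x r])
  moreover have "\<phi> ?r = face_refl (face_join (\<phi> x) (\<phi> y)) (\<phi> y)"
    using \<phi> x y j by (simp add: cube_Aut_refl cube_Aut_join)
  ultimately show ?thesis
    unfolding face_caret_def by (metis face_meet_eqI)
qed

text \<open>Intersecting with \<open>cube n\<close> matters: \<open>\<phi>\<close> is extended by
  the identity, so it also fixes every pair outside the cube.\<close>

definition fixed_faces :: "nat \<Rightarrow> (face \<Rightarrow> face) \<Rightarrow> face set" where
  "fixed_faces n \<phi> = {x \<in> cube n. \<phi> x = x}"

lemma MR_subalgebra_fixed_faces:
  assumes "\<phi> \<in> cube_Aut n"
  shows "MR_subalgebra n (fixed_faces n \<phi>)"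
  using assms
  by (auto simp: MR_subalgebra_def fixed_faces_def face_one_in_cube cube_Aut_one
      face_join_in_cube cube_Aut_join face_refl_in_cube cube_Aut_refl
      face_caret_in_cube cube_Aut_caret)

lemma fixes_on_iff_subset_fixed_faces:
  "A \<subseteq> cube n \<Longrightarrow> fixes_on \<phi> A \<longleftrightarrow> A \<subseteq> fixed_faces n \<phi>"
  by (auto simp: fixes_on_def fixed_faces_def)

text \<open>If \<open>A\<close> lies strictly inside \<open>fixed_faces n \<phi>\<close>, that set
  is itself an MR-subalgebra and serves as the forbidden \<open>B\<close>; conversely, any fixed
  \<open>B\<close> is contained in it.\<close>

lemma num_fixing_exactly_eq:
  assumes "MR_subalgebra n A"
  shows "num_fixing_exactly n A = card {\<phi> \<in> cube_Aut n. fixed_faces n \<phi> = A}"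
proof -
  have "fixes_on \<phi> A \<and> (\<forall>B. MR_subalgebra n B \<longrightarrow> A \<subset> B \<longrightarrow> \<not> fixes_on \<phi> B) \<longleftrightarrow>
        fixed_faces n \<phi> = A" if \<phi>: "\<phi> \<in> cube_Aut n" for \<phi>
  proof -
    have "fixes_on \<phi> B \<longleftrightarrow> B \<subseteq> fixed_faces n \<phi>" if "MR_subalgebra n B" for B
      using that by (intro fixes_on_iff_subset_fixed_faces) (simp add: MR_subalgebra_def)
    then show ?thesis
      using assms MR_subalgebra_fixed_faces [OF \<phi>] by blast
  qed
  then show ?thesis
    unfolding num_fixing_exactly_def by (intro arg_cong [where f = card]) blast
qed

lemma num_fixing_eq:
  assumes "MR_subalgebra n A"
  shows "num_fixing n A = card {\<phi> \<in> cube_Aut n. A \<subseteq> fixed_faces n \<phi>}"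
  using assms fixes_on_iff_subset_fixed_faces [of A n]
  by (simp add: num_fixing_def MR_subalgebra_def)

text \<open>For \<open>x < y\<close> the recursion makes the top term \<open>z = y\<close> the
  negative of the sum of all the others.\<close>

lemma sum_moebius_interval:
  fixes x y :: "'a::order"
  assumes "finite P" "x \<in> P" "y \<in> P" "x \<le> y"
  shows "(\<Sum>z\<in>{z\<in>P. x \<le> z \<and> z \<le> y}. moebius P x z) = (if x = y then 1 else 0)"
proof (cases "x = y")
  case True
  then have "{z\<in>P. x \<le> z \<and> z \<le> y} = {x}"
    using assms by auto
  then show ?thesis
    using assms True by (simp add: moebius.simps)
next
  case False
  have "{z\<in>P. x \<le> z \<and> z \<le> y} = insert y {z\<in>P. x \<le> z \<and> z < y}"
    using assms by auto
  moreover have "moebius P x y = - (\<Sum>z\<in>{z\<in>P. x \<le> z \<and> z < y}. moebius P x z)"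
    using assms False by (subst moebius.simps) simp
  ultimately show ?thesis
    using assms False by simp
qed

text \<open>Moebius inversion from above, in counting form: writing each cardinality as a sum of
  indicators and swapping the sums leaves, for each \<open>u\<close>, a sum over the interval from
  \<open>x\<close> to \<open>c u\<close>.\<close>

lemma moebius_inversion_card:
  fixes c :: "'b \<Rightarrow> 'a::order"
  assumes P: "finite P" and U: "finite U" and c: "\<And>u. u \<in> U \<Longrightarrow> c u \<in> P" and x: "x \<in> P"
  shows "int (card {u\<in>U. c u = x}) =
         (\<Sum>y\<in>{y\<in>P. x \<le> y}. moebius P x y * int (card {u\<in>U. y \<le> c u}))"
proof -
  have "(\<Sum>y\<in>{y\<in>P. x \<le> y}. moebius P x y * int (card {u\<in>U. y \<le> c u})) =
        (\<Sum>y\<in>{y\<in>P. x \<le> y}. \<Sum>u\<in>U. if y \<le> c u then moebius P x y else 0)"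
    using U by (intro sum.cong) (simp_all flip: sum.inter_filter)
  also have "\<dots> = (\<Sum>u\<in>U. \<Sum>y\<in>{y\<in>P. x \<le> y}. if y \<le> c u then moebius P x y else 0)"
    by (rule sum.swap)
  also have "\<dots> = (\<Sum>u\<in>U. if c u = x then 1 else 0)"
  proof (rule sum.cong [OF refl])
    fix u assume u: "u \<in> U"
    have "(\<Sum>y\<in>{y\<in>P. x \<le> y}. if y \<le> c u then moebius P x y else 0) =
          (\<Sum>y\<in>{y\<in>P. x \<le> y \<and> y \<le> c u}. moebius P x y)"
      using P by (auto simp flip: sum.inter_filter intro: sum.cong)
    also have "\<dots> = (if c u = x then 1 else 0)"
    proof (cases "x \<le> c u")
      case True
      then show ?thesis
        using sum_moebius_interval [OF P x c [OF u]] by auto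
    next
      case False
      \<comment> \<open>By transitivity the interval is empty, and reflexivity rules out
        \<open>c u = x\<close>, so both sides are 0.\<close>
      then have "{y\<in>P. x \<le> y \<and> y \<le> c u} = {}" "c u \<noteq> x"
        by (auto dest: order_trans)
      then show ?thesis
        by (simp del: Collect_empty_eq)
    qed
    finally show "(\<Sum>y\<in>{y\<in>P. x \<le> y}. if y \<le> c u then moebius P x y else 0) =
                  (if c u = x then 1 else 0)" .
  qed
  also have "\<dots> = int (card {u\<in>U. c u = x})"
    using U by (simp flip: sum.inter_filter)
  finally show ?thesis ..
qed

theorem mainTheorem3:
  fixes n :: nat
  assumes "n \<ge> 1"
  shows "(\<forall>A. MR_subalgebra n A \<longrightarrow>
            int (num_fixing_exactly n A) =
              (\<Sum>B\<in>{B. MR_subalgebra n B \<and> A \<subseteq> B}.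
                 moebius {C. MR_subalgebra n C} A B * int (num_fixing n B)))
       \<and> card (cube_derangements n) = num_fixing_exactly n {face_one}
       \<and> int (num_fixing_exactly n {face_one}) =
           (\<Sum>B\<in>{B. MR_subalgebra n B}.
              moebius {C. MR_subalgebra n C} {face_one} B * int (num_fixing n B))"
proof -
  have inversion: "int (num_fixing_exactly n A) =
      (\<Sum>B\<in>{B. MR_subalgebra n B \<and> A \<subseteq> B}.
         moebius {C. MR_subalgebra n C} A B * int (num_fixing n B))"
    if A: "MR_subalgebra n A" for A
  proof -
    have "int (num_fixing_exactly n A) =
        (\<Sum>B\<in>{B \<in> {C. MR_subalgebra n C}. A \<subseteq> B}. moebius {C. MR_subalgebra n C} A B *
           int (card {\<phi> \<in> cube_Aut n. B \<subseteq> fixed_faces n \<phi>}))"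
      unfolding num_fixing_exactly_eq [OF A]
      \<comment> \<open>Here \<open>P\<close> is the set of MR-subalgebras under inclusion,
        \<open>U\<close> is \<open>cube_Aut n\<close> and \<open>c\<close> is
        \<open>fixed_faces n\<close>.\<close>
      by (rule moebius_inversion_card)
         (simp_all add: A finite_MR_subalgebras finite_cube_Aut MR_subalgebra_fixed_faces)
    also have "\<dots> = (\<Sum>B\<in>{B. MR_subalgebra n B \<and> A \<subseteq> B}.
        moebius {C. MR_subalgebra n C} A B * int (num_fixing n B))"
      by (intro sum.cong) (simp_all add: num_fixing_eq)
    finally show ?thesis .
  qed
  \<comment> \<open>A derangement is exactly an automorphism whose \<open>fixed_faces\<close> is
    \<open>{face_one}\<close>.\<close>
  have "card (cube_derangements n) = num_fixing_exactly n {face_one}"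
    by (simp add: cube_derangements_def num_fixing_exactly_eq MR_subalgebra_one fixed_faces_def)
  \<comment> \<open>Every MR-subalgebra contains the maximum, so for \<open>A = {face_one}\<close>
    the sum runs over all of them.\<close>
  moreover have "{B. MR_subalgebra n B \<and> {face_one} \<subseteq> B} = {B. MR_subalgebra n B}"
    by (auto simp: MR_subalgebra_def)
  ultimately show ?thesis
    using inversion inversion [OF MR_subalgebra_one] by simp
qed

end
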